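(* Let $X$ and $Y$ be real Banach spaces, let $x_0^*\in S_{X^*}$ and $y_0^*\in S_{Y^*}$. Suppose that the rank one operator $x_0^*\otimes y_0^*\in S_{\mathcal{L}(X,Y^* )}$ is a Namioka point of $B_{\mathcal{L}(X,Y^* )}$. Then $x_0^*$ is a Namioka point of $B_{X^*}$ and $y_0^*$ is a Namioka point of $B_{Y^*}$.
   Context: $B_Z$ and $S_Z$ denote the closed unit ball and unit sphere of a Banach space $Z$. A point $z_0^*\in B_{Z^*}$ is a Namioka point of $B_{Z^*}$ if the identity map $(B_{Z^*},\text{weak}^* )\to(B_{Z^*},\text{weak})$ is continuous at $z_0^*$, where the weak topology on $Z^*$ is the one induced by $Z^{**}$. $\mathcal{L}(X,Y^* )$ is the space of bounded linear operators from $X$ to $Y^*$ with the operator norm; it is identified isometrically with the dual of the projective tensor product $X\hat{\otimes}_\pi Y$ via $T(x\otimes y)=(Tx)(y)$, and its weak$^*$-topology is always the one coming from this predual. $x_0^*\otimes y_0^*$ is the operator $x\mapsto x_0^*(x)\,y_0^*$. *)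

theory Defs
  imports "HOL-Analysis.Analysis"
begin

section \<open>The algebraic tensor product\<close>

definition tensor_eval :: "('a \<Rightarrow> 'b \<Rightarrow> real) \<Rightarrow> ('a \<times> 'b) list \<Rightarrow> real"
  where "tensor_eval B xs = (\<Sum>(x, y)\<leftarrow>xs. B x y)"

text \<open>A list \<open>[(x\<^sub>1, y\<^sub>1), \<dots>, (x\<^sub>n, y\<^sub>n)]\<close> stands for \<open>x\<^sub>1 \<otimes> y\<^sub>1 + \<dots> + x\<^sub>n \<otimes> y\<^sub>n\<close>. Tensors are, as
  usual, linear functionals on the space of all (not only the bounded) bilinear forms: two formal
  sums are the same tensor iff no bilinear form tells them apart.\<close>

definition tensor_rel :: "('a::real_vector \<times> 'b::real_vector) list \<Rightarrow> ('a \<times> 'b) list \<Rightarrow> bool"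
  where "tensor_rel xs ys \<longleftrightarrow> (\<forall>B. bilinear B \<longrightarrow> tensor_eval B xs = tensor_eval B ys)"

quotient_type (overloaded) ('a, 'b) tensor =
  "('a::real_vector \<times> 'b::real_vector) list" / tensor_rel
  by (auto simp: tensor_rel_def intro!: equivpI reflpI sympI transpI)

lemma tensor_eval_simps:
  "tensor_eval B [] = 0"
  "tensor_eval B (xs @ ys) = tensor_eval B xs + tensor_eval B ys"
  "tensor_eval B ((x, y) # xs) = B x y + tensor_eval B xs"
  by (auto simp: tensor_eval_def)

lemma tensor_eval_scale:
  "bilinear B \<Longrightarrow> tensor_eval B (map (\<lambda>(x, y). (c *\<^sub>R x, y)) xs) = c * tensor_eval B xs"
  by (induction xs) (auto simp: tensor_eval_simps bilinear_lmul algebra_simps)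

instantiation tensor :: (real_vector, real_vector) real_vector
begin

lift_definition zero_tensor :: "('a, 'b) tensor" is "[]" .

lift_definition plus_tensor :: "('a, 'b) tensor \<Rightarrow> ('a, 'b) tensor \<Rightarrow> ('a, 'b) tensor" is "(@)"
  by (auto simp: tensor_rel_def tensor_eval_simps)

lift_definition scaleR_tensor :: "real \<Rightarrow> ('a, 'b) tensor \<Rightarrow> ('a, 'b) tensor"
  is "\<lambda>c. map (\<lambda>(x, y). (c *\<^sub>R x, y))"
  by (auto simp: tensor_rel_def tensor_eval_scale)

definition uminus_tensor :: "('a, 'b) tensor \<Rightarrow> ('a, 'b) tensor"
  where "uminus_tensor t = (-1) *\<^sub>R t"

definition minus_tensor :: "('a, 'b) tensor \<Rightarrow> ('a, 'b) tensor \<Rightarrow> ('a, 'b) tensor"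
  where "minus_tensor s t = s + - (t :: ('a, 'b) tensor)"

instance
proof
  fix r s t :: "('a, 'b) tensor" and a b :: real
  show "r + s + t = r + (s + t)"
    by transfer (simp add: tensor_rel_def)
  show "s + t = t + s"
    by transfer (simp add: tensor_rel_def tensor_eval_simps)
  show "0 + s = s"
    by transfer (simp add: tensor_rel_def)
  show "- s + s = 0"
    unfolding uminus_tensor_def
    by transfer (simp add: tensor_rel_def tensor_eval_simps tensor_eval_scale
        del: scaleR_minus_left scaleR_minus1_left)
  show "s - t = s + - t"
    by (rule minus_tensor_def)
  show "a *\<^sub>R (s + t) = a *\<^sub>R s + a *\<^sub>R t"
    by transfer (simp add: tensor_rel_def)
  show "(a + b) *\<^sub>R s = a *\<^sub>R s + b *\<^sub>R s"
    by transfer (simp add: tensor_rel_def tensor_eval_simps tensor_eval_scale distrib_right)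
  show "a *\<^sub>R b *\<^sub>R s = (a * b) *\<^sub>R s"
    by transfer (simp add: tensor_rel_def tensor_eval_scale del: map_map)
  show "1 *\<^sub>R s = s"
    by transfer (simp add: tensor_rel_def tensor_eval_scale)
qed

end

section \<open>The projective norm\<close>

definition projective_norm ::
    "('a::real_normed_vector, 'b::real_normed_vector) tensor \<Rightarrow> real"
  where "projective_norm t = (INF xs\<in>{xs. abs_tensor xs = t}. \<Sum>(x, y)\<leftarrow>xs. norm x * norm y)"

lemma sum_norms_nonneg:
  "0 \<le> (\<Sum>(x, y)\<leftarrow>xs. norm (x::'a::real_normed_vector) * norm (y::'b::real_normed_vector))"
  by (induction xs) auto

lemma projective_norm_le: "projective_norm (abs_tensor xs) \<le> (\<Sum>(x, y)\<leftarrow>xs. norm x * norm y)"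
  unfolding projective_norm_def
  by (rule cINF_lower) (auto intro!: bdd_belowI2[where m = 0] sum_norms_nonneg)

lemma ex_abs_tensor: "\<exists>xs. abs_tensor xs = t"
  using Quotient3_abs_rep[OF Quotient3_tensor] by blast

lemma projective_norm_nonneg: "0 \<le> projective_norm t"
  unfolding projective_norm_def
  using ex_abs_tensor[of t] by (intro cINF_greatest) (auto intro!: sum_norms_nonneg)

lemma projective_norm_approx:
  assumes "0 < e"
  obtains xs where "abs_tensor xs = t" "(\<Sum>(x, y)\<leftarrow>xs. norm x * norm y) < projective_norm t + e"
proof -
  have "bdd_below ((\<lambda>xs. \<Sum>(x, y)\<leftarrow>xs. norm x * norm y) ` {xs. abs_tensor xs = t})"
    by (auto intro!: bdd_belowI2[where m = 0] sum_norms_nonneg)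
  then have "\<exists>xs\<in>{xs. abs_tensor xs = t}.
      (\<Sum>(x, y)\<leftarrow>xs. norm x * norm y) < projective_norm t + e"
    using assms ex_abs_tensor[of t] unfolding projective_norm_def
    by (intro cINF_less_iff[THEN iffD1]) auto
  then show thesis using that by blast
qed

lemma projective_norm_triangle:
  "projective_norm (s + t) \<le> projective_norm s + projective_norm t"
proof (rule field_le_epsilon)
  fix e :: real assume "0 < e"
  then have "0 < e / 2" by simp
  then obtain xs where xs: "abs_tensor xs = s"
    "(\<Sum>(x, y)\<leftarrow>xs. norm x * norm y) < projective_norm s + e / 2"
    by (rule projective_norm_approx)
  obtain ys where ys: "abs_tensor ys = t"
    "(\<Sum>(x, y)\<leftarrow>ys. norm x * norm y) < projective_norm t + e / 2"
    using \<open>0 < e / 2\<close> by (rule projective_norm_approx)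
  have "s + t = abs_tensor (xs @ ys)"
    unfolding xs(1)[symmetric] ys(1)[symmetric] by (rule plus_tensor.abs_eq)
  then have "projective_norm (s + t)
      \<le> (\<Sum>(x, y)\<leftarrow>xs. norm x * norm y) + (\<Sum>(x, y)\<leftarrow>ys. norm x * norm y)"
    using projective_norm_le[of "xs @ ys"] by simp
  with xs(2) ys(2) show "projective_norm (s + t) \<le> projective_norm s + projective_norm t + e"
    by linarith
qed

lemma projective_norm_scale_le: "projective_norm (c *\<^sub>R t) \<le> \<bar>c\<bar> * projective_norm t"
proof (rule field_le_epsilon)
  fix e :: real assume "0 < e"
  define d where "d = e / (\<bar>c\<bar> + 1)"
  have d: "0 < d" "\<bar>c\<bar> * d \<le> e"
    using \<open>0 < e\<close> by (auto simp: d_def field_simps)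
  obtain xs where xs: "abs_tensor xs = t"
    "(\<Sum>(x, y)\<leftarrow>xs. norm x * norm y) < projective_norm t + d"
    using d(1) by (rule projective_norm_approx)
  have eq: "c *\<^sub>R t = abs_tensor (map (\<lambda>(x, y). (c *\<^sub>R x, y)) xs)"
    unfolding xs(1)[symmetric] by (rule scaleR_tensor.abs_eq)
  have "(\<Sum>(x, y)\<leftarrow>map (\<lambda>(x, y). (c *\<^sub>R x, y)) xs. norm x * norm y)
      = \<bar>c\<bar> * (\<Sum>(x, y)\<leftarrow>xs. norm x * norm y)"
    by (induction xs) (auto simp: algebra_simps)
  then have "projective_norm (c *\<^sub>R t) \<le> \<bar>c\<bar> * (\<Sum>(x, y)\<leftarrow>xs. norm x * norm y)"
    unfolding eq using projective_norm_le[of "map (\<lambda>(x, y). (c *\<^sub>R x, y)) xs"] by simp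
  also have "\<dots> \<le> \<bar>c\<bar> * (projective_norm t + d)"
    using xs(2) by (intro mult_left_mono) auto
  also have "\<dots> \<le> \<bar>c\<bar> * projective_norm t + e"
    using d(2) by (simp add: algebra_simps)
  finally show "projective_norm (c *\<^sub>R t) \<le> \<bar>c\<bar> * projective_norm t + e" .
qed

lemma projective_norm_zero [simp]:
  "projective_norm (0 :: ('a::real_normed_vector, 'b::real_normed_vector) tensor) = 0"
  using projective_norm_scale_le[of 0 "0 :: ('a, 'b) tensor"]
    projective_norm_nonneg[of "0 :: ('a, 'b) tensor"]
  unfolding scaleR_zero_left abs_zero mult_zero_left by (rule antisym)

lemma projective_norm_scale: "projective_norm (c *\<^sub>R t) = \<bar>c\<bar> * projective_norm t"
proof (cases "c = 0")
  case True
  have "projective_norm (0 *\<^sub>R t) = 0" by (subst scaleR_zero_left) (rule projective_norm_zero)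
  with True show ?thesis by (metis abs_zero mult_zero_left)
next
  case False
  have "projective_norm t = projective_norm (inverse c *\<^sub>R (c *\<^sub>R t))" using False by simp
  also have "\<dots> \<le> \<bar>inverse c\<bar> * projective_norm (c *\<^sub>R t)" by (rule projective_norm_scale_le)
  finally have "\<bar>c\<bar> * projective_norm t \<le> \<bar>c\<bar> * (\<bar>inverse c\<bar> * projective_norm (c *\<^sub>R t))"
    by (rule mult_left_mono) simp
  also have "\<dots> = projective_norm (c *\<^sub>R t)"
    using False by (simp add: abs_inverse)
  finally show ?thesis using projective_norm_scale_le[of c t] by linarith
qed

lemma projective_norm_minus_commute: "projective_norm (s - t) = projective_norm (t - s)"
proof -
  have "t - s = (-1) *\<^sub>R (s - t)" by simp
  then show ?thesis using projective_norm_scale[of "-1" "s - t"] by simp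
qed

lemma projective_norm_diff_triangle:
  "projective_norm (r - t) \<le> projective_norm (r - s) + projective_norm (s - t)"
proof -
  have "r - t = (r - s) + (s - t)" by (metis add_diff_eq diff_add_cancel)
  then show ?thesis using projective_norm_triangle[of "r - s" "s - t"] by metis
qed

lemma projective_norm_abs_diff: "\<bar>projective_norm s - projective_norm t\<bar> \<le> projective_norm (s - t)"
proof -
  have "projective_norm s \<le> projective_norm (s - t) + projective_norm t"
    using projective_norm_triangle[of "s - t" t] unfolding diff_add_cancel .
  moreover have "projective_norm t \<le> projective_norm (s - t) + projective_norm s"
    using projective_norm_triangle[of "t - s" s]
    unfolding diff_add_cancel projective_norm_minus_commute[of t s] .
  ultimately show ?thesis by linarith
qed

section \<open>The projective tensor product\<close>

text \<open>The completion of the algebraic tensor product in the projective norm: Cauchy sequences modulo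
  null sequences. That \<^const>\<open>projective_norm\<close> vanishes at \<open>0\<close> only is true, but a completion does
  not depend on it.\<close>

definition projective_Cauchy ::
    "(nat \<Rightarrow> ('a::real_normed_vector, 'b::real_normed_vector) tensor) \<Rightarrow> bool"
  where "projective_Cauchy u \<longleftrightarrow> (\<forall>e>0. \<exists>N. \<forall>m\<ge>N. \<forall>n\<ge>N. projective_norm (u m - u n) < e)"

definition ptensor_rel :: "(nat \<Rightarrow> ('a::real_normed_vector, 'b::real_normed_vector) tensor) \<Rightarrow>
    (nat \<Rightarrow> ('a, 'b) tensor) \<Rightarrow> bool"
  where "ptensor_rel u v \<longleftrightarrow> projective_Cauchy u \<and> projective_Cauchy v \<and>
    (\<lambda>n. projective_norm (u n - v n)) \<longlonglongrightarrow> 0"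

lemma projective_Cauchy_const: "projective_Cauchy (\<lambda>n. t)"
  by (auto simp: projective_Cauchy_def)

lemma null_add:
  assumes "f \<longlonglongrightarrow> 0" "g \<longlonglongrightarrow> 0" "\<And>n. 0 \<le> h n" "\<And>n. h n \<le> f n + g n"
  shows "h \<longlonglongrightarrow> (0::real)"
  using assms
  by (intro tendsto_sandwich[of "\<lambda>_. 0" h sequentially "\<lambda>n. f n + g n"])
    (auto intro!: tendsto_eq_intros)

lemma part_equivp_ptensor_rel: "part_equivp
  (ptensor_rel :: (nat \<Rightarrow> ('a::real_normed_vector, 'b::real_normed_vector) tensor) \<Rightarrow> _)"
proof (rule part_equivpI)
  show "\<exists>u. ptensor_rel u (u :: nat \<Rightarrow> ('a, 'b) tensor)"
    by (rule exI[of _ "\<lambda>n. 0"]) (simp add: ptensor_rel_def projective_Cauchy_const)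
  show "symp (ptensor_rel :: (nat \<Rightarrow> ('a, 'b) tensor) \<Rightarrow> _)"
    by (auto intro!: sympI simp: ptensor_rel_def projective_norm_minus_commute)
  show "transp (ptensor_rel :: (nat \<Rightarrow> ('a, 'b) tensor) \<Rightarrow> _)"
  proof (rule transpI)
    fix u v w :: "nat \<Rightarrow> ('a, 'b) tensor"
    assume "ptensor_rel u v" "ptensor_rel v w"
    then show "ptensor_rel u w"
      unfolding ptensor_rel_def
      using null_add[of "\<lambda>n. projective_norm (u n - v n)" "\<lambda>n. projective_norm (v n - w n)"
          "\<lambda>n. projective_norm (u n - w n)"]
      by (auto simp: projective_norm_nonneg projective_norm_diff_triangle)
  qed
qed

quotient_type (overloaded) ('a, 'b) ptensor =
  "nat \<Rightarrow> ('a::real_normed_vector, 'b::real_normed_vector) tensor" / partial: ptensor_rel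
  by (rule part_equivp_ptensor_rel)

lemma projective_Cauchy_add:
  assumes "projective_Cauchy u" "projective_Cauchy v"
  shows "projective_Cauchy (\<lambda>n. u n + v n)"
  unfolding projective_Cauchy_def
proof (intro allI impI)
  fix e :: real assume "0 < e"
  then have "0 < e / 2" by simp
  then obtain M N where M: "\<forall>m\<ge>M. \<forall>n\<ge>M. projective_norm (u m - u n) < e / 2"
    and N: "\<forall>m\<ge>N. \<forall>n\<ge>N. projective_norm (v m - v n) < e / 2"
    using assms unfolding projective_Cauchy_def by meson
  show "\<exists>K. \<forall>m\<ge>K. \<forall>n\<ge>K. projective_norm (u m + v m - (u n + v n)) < e"
  proof (intro exI[of _ "max M N"] allI impI)
    fix m n assume "max M N \<le> m" "max M N \<le> n"
    then have "projective_norm (u m - u n) < e / 2" "projective_norm (v m - v n) < e / 2"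
      using M N by auto
    then show "projective_norm (u m + v m - (u n + v n)) < e"
      using projective_norm_triangle[of "u m - u n" "v m - v n"] by (simp add: algebra_simps)
  qed
qed

lemma projective_Cauchy_scale:
  assumes "projective_Cauchy u"
  shows "projective_Cauchy (\<lambda>n. c *\<^sub>R u n)"
  unfolding projective_Cauchy_def
proof (intro allI impI)
  fix e :: real assume "0 < e"
  define d where "d = e / (\<bar>c\<bar> + 1)"
  have d: "0 < d" using \<open>0 < e\<close> by (auto simp: d_def)
  then obtain N where N: "\<forall>m\<ge>N. \<forall>n\<ge>N. projective_norm (u m - u n) < d"
    using assms unfolding projective_Cauchy_def by meson
  show "\<exists>K. \<forall>m\<ge>K. \<forall>n\<ge>K. projective_norm (c *\<^sub>R u m - c *\<^sub>R u n) < e"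
  proof (intro exI[of _ N] allI impI)
    fix m n assume "N \<le> m" "N \<le> n"
    then have "projective_norm (u m - u n) < d" using N by auto
    then have "\<bar>c\<bar> * projective_norm (u m - u n) \<le> \<bar>c\<bar> * d"
      by (intro mult_left_mono) auto
    also have "\<dots> < e" using \<open>0 < e\<close> by (auto simp: d_def field_simps)
    finally show "projective_norm (c *\<^sub>R u m - c *\<^sub>R u n) < e"
      by (simp add: projective_norm_scale flip: scaleR_right_diff_distrib)
  qed
qed

lemma projective_norm_Cauchy:
  assumes "projective_Cauchy u"
  shows "convergent (\<lambda>n. projective_norm (u n))"
proof (rule Cauchy_convergent, rule metric_CauchyI)
  fix e :: real assume "0 < e"
  then obtain N where "\<forall>m\<ge>N. \<forall>n\<ge>N. projective_norm (u m - u n) < e"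
    using assms unfolding projective_Cauchy_def by meson
  then show "\<exists>N. \<forall>m\<ge>N. \<forall>n\<ge>N. dist (projective_norm (u m)) (projective_norm (u n)) < e"
    unfolding dist_real_def using projective_norm_abs_diff by (meson order_le_less_trans)
qed

lemma lim_cong_null:
  fixes f g :: "nat \<Rightarrow> real"
  assumes "convergent f" "(\<lambda>n. f n - g n) \<longlonglongrightarrow> 0"
  shows "lim f = lim g"
proof -
  have "f \<longlonglongrightarrow> lim f" using assms(1) by (simp add: convergent_LIMSEQ_iff)
  from tendsto_diff[OF this assms(2)] have "g \<longlonglongrightarrow> lim f" by simp
  then show ?thesis by (simp add: limI)
qed

lemma null_le:
  fixes f g :: "nat \<Rightarrow> real"
  assumes "g \<longlonglongrightarrow> 0" "\<And>n. \<bar>f n\<bar> \<le> g n"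
  shows "f \<longlonglongrightarrow> 0"
  using assms by (intro Lim_null_comparison[of f g]) auto

lemma ptensor_rel_refl: "projective_Cauchy u \<Longrightarrow> ptensor_rel u u"
  by (simp add: ptensor_rel_def)

lemma ptensor_rel_Cauchy: "ptensor_rel u u \<longleftrightarrow> projective_Cauchy u"
  by (simp add: ptensor_rel_def)

instantiation ptensor :: (real_normed_vector, real_normed_vector) real_normed_vector
begin

lift_definition zero_ptensor :: "('a, 'b) ptensor" is "\<lambda>n. 0"
  by (simp add: ptensor_rel_def projective_Cauchy_const)

lift_definition plus_ptensor :: "('a, 'b) ptensor \<Rightarrow> ('a, 'b) ptensor \<Rightarrow> ('a, 'b) ptensor"
  is "\<lambda>u v n. u n + v n"
proof -
  fix u u' v v' :: "nat \<Rightarrow> ('a, 'b) tensor"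
  assume "ptensor_rel u u'" "ptensor_rel v v'"
  moreover have "projective_norm (u n + v n - (u' n + v' n))
      \<le> projective_norm (u n - u' n) + projective_norm (v n - v' n)" for n
    using projective_norm_triangle[of "u n - u' n" "v n - v' n"] by (simp add: algebra_simps)
  ultimately show "ptensor_rel (\<lambda>n. u n + v n) (\<lambda>n. u' n + v' n)"
    unfolding ptensor_rel_def
    using null_add[of "\<lambda>n. projective_norm (u n - u' n)" "\<lambda>n. projective_norm (v n - v' n)"
        "\<lambda>n. projective_norm (u n + v n - (u' n + v' n))"]
    by (auto simp: projective_norm_nonneg projective_Cauchy_add)
qed

lift_definition scaleR_ptensor :: "real \<Rightarrow> ('a, 'b) ptensor \<Rightarrow> ('a, 'b) ptensor"
  is "\<lambda>c u n. c *\<^sub>R u n"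
proof -
  fix c and u v :: "nat \<Rightarrow> ('a, 'b) tensor"
  assume *: "ptensor_rel u v"
  then have "(\<lambda>n. \<bar>c\<bar> * projective_norm (u n - v n)) \<longlonglongrightarrow> \<bar>c\<bar> * 0"
    unfolding ptensor_rel_def by (intro tendsto_intros) auto
  with * show "ptensor_rel (\<lambda>n. c *\<^sub>R u n) (\<lambda>n. c *\<^sub>R v n)"
    unfolding ptensor_rel_def
    by (auto simp: projective_Cauchy_scale projective_norm_scale simp flip: scaleR_right_diff_distrib)
qed

definition uminus_ptensor :: "('a, 'b) ptensor \<Rightarrow> ('a, 'b) ptensor"
  where "uminus_ptensor t = (-1) *\<^sub>R t"

definition minus_ptensor :: "('a, 'b) ptensor \<Rightarrow> ('a, 'b) ptensor \<Rightarrow> ('a, 'b) ptensor"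
  where "minus_ptensor s t = s + - (t :: ('a, 'b) ptensor)"

lift_definition norm_ptensor :: "('a, 'b) ptensor \<Rightarrow> real" is "\<lambda>u. lim (\<lambda>n. projective_norm (u n))"
proof -
  fix u v :: "nat \<Rightarrow> ('a, 'b) tensor"
  assume "ptensor_rel u v"
  then show "lim (\<lambda>n. projective_norm (u n)) = lim (\<lambda>n. projective_norm (v n))"
    unfolding ptensor_rel_def
    by (intro lim_cong_null projective_norm_Cauchy)
      (auto intro: null_le[where g = "\<lambda>n. projective_norm (u n - v n)"] projective_norm_abs_diff)
qed

definition dist_ptensor :: "('a, 'b) ptensor \<Rightarrow> ('a, 'b) ptensor \<Rightarrow> real"
  where "dist_ptensor s t = norm (s - t)"

definition sgn_ptensor :: "('a, 'b) ptensor \<Rightarrow> ('a, 'b) ptensor"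
  where "sgn_ptensor t = inverse (norm t) *\<^sub>R t"

definition uniformity_ptensor :: "(('a, 'b) ptensor \<times> ('a, 'b) ptensor) filter"
  where "uniformity_ptensor = (INF e\<in>{0<..}. principal {(x, y). dist x y < e})"

definition open_ptensor :: "('a, 'b) ptensor set \<Rightarrow> bool"
  where "open_ptensor S \<longleftrightarrow> (\<forall>x\<in>S. \<forall>\<^sub>F (x', y) in uniformity. x' = x \<longrightarrow> y \<in> S)"

lemma norm_ptensor_LIMSEQ:
  assumes "projective_Cauchy u"
  shows "(\<lambda>n. projective_norm (u n)) \<longlonglongrightarrow> norm (abs_ptensor u)"
  using projective_norm_Cauchy[OF assms] norm_ptensor.abs_eq[OF ptensor_rel_refl[OF assms]]
  by (simp add: convergent_LIMSEQ_iff)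

lemma ptensor_cases:
  obtains u where "projective_Cauchy u" "t = abs_ptensor u"
  using Quotient3_abs_rep[OF Quotient3_ptensor, of t] Quotient3_rep_reflp[OF Quotient3_ptensor, of t]
    ptensor_rel_Cauchy by metis

instance
proof
  fix s t r :: "('a, 'b) ptensor" and a b :: real
  show "s + t + r = s + (t + r)" "s + t = t + s" "0 + s = s" "1 *\<^sub>R s = s"
    by (transfer, simp add: algebra_simps ptensor_rel_Cauchy projective_Cauchy_add
        projective_Cauchy_scale)+
  show "- s + s = 0"
    unfolding uminus_ptensor_def
    by (transfer, simp add: ptensor_rel_Cauchy projective_Cauchy_const)
  show "s - t = s + - t" by (simp add: minus_ptensor_def)
  show "a *\<^sub>R (s + t) = a *\<^sub>R s + a *\<^sub>R t" "(a + b) *\<^sub>R s = a *\<^sub>R s + b *\<^sub>R s"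
    "a *\<^sub>R b *\<^sub>R s = (a * b) *\<^sub>R s"
    by (transfer, simp add: scaleR_add_right scaleR_add_left ptensor_rel_Cauchy
        projective_Cauchy_add projective_Cauchy_scale)+
  show "dist s t = norm (s - t)" by (rule dist_ptensor_def)
  show "sgn s = inverse (norm s) *\<^sub>R s" by (rule sgn_ptensor_def)
  show "(uniformity :: (('a, 'b) ptensor \<times> ('a, 'b) ptensor) filter)
      = (INF e\<in>{0<..}. principal {(x, y). dist x y < e})" by (rule uniformity_ptensor_def)
  show "open S \<longleftrightarrow> (\<forall>x\<in>S. \<forall>\<^sub>F (x', y) in uniformity. x' = x \<longrightarrow> y \<in> S)"
    for S :: "('a, 'b) ptensor set" by (rule open_ptensor_def)
  obtain u where u: "projective_Cauchy u" "s = abs_ptensor u" by (rule ptensor_cases)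
  obtain v where v: "projective_Cauchy v" "t = abs_ptensor v" by (rule ptensor_cases)
  note U = norm_ptensor_LIMSEQ[OF u(1), folded u(2)]
  note V = norm_ptensor_LIMSEQ[OF v(1), folded v(2)]
  show "norm s = 0 \<longleftrightarrow> s = 0"
  proof
    assume "norm s = 0"
    with U u show "s = 0"
      by (simp add: zero_ptensor_def Quotient3_rel_abs[OF Quotient3_ptensor] ptensor_rel_def
          projective_Cauchy_const)
  next
    assume "s = 0"
    then show "norm s = 0"
      by transfer (simp add: ptensor_rel_def limI)
  qed
  have st: "s + t = abs_ptensor (\<lambda>n. u n + v n)"
    using u v by (simp add: plus_ptensor.abs_eq ptensor_rel_Cauchy)
  show "norm (s + t) \<le> norm s + norm t"
    using norm_ptensor_LIMSEQ[OF projective_Cauchy_add[OF u(1) v(1)], folded st]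
      tendsto_add[OF U V]
    by (rule LIMSEQ_le) (auto intro: projective_norm_triangle)
  have as: "a *\<^sub>R s = abs_ptensor (\<lambda>n. a *\<^sub>R u n)"
    using u by (simp add: scaleR_ptensor.abs_eq ptensor_rel_Cauchy)
  show "norm (a *\<^sub>R s) = \<bar>a\<bar> * norm s"
    using norm_ptensor_LIMSEQ[OF projective_Cauchy_scale[OF u(1), of a], folded as]
      tendsto_mult_left[OF U, of "\<bar>a\<bar>"]
    by (auto simp: projective_norm_scale intro: LIMSEQ_unique)
qed

end

definition tensor_to_ptensor ::
    "('a::real_normed_vector, 'b::real_normed_vector) tensor \<Rightarrow> ('a, 'b) ptensor"
  where "tensor_to_ptensor t = abs_ptensor (\<lambda>n. t)"

lemma norm_tensor_to_ptensor: "norm (tensor_to_ptensor t) = projective_norm t"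
  unfolding tensor_to_ptensor_def
  using norm_ptensor_LIMSEQ[OF projective_Cauchy_const, of t] by (simp add: LIMSEQ_const_iff)

lemma abs_ptensor_diff:
  assumes "projective_Cauchy u" "projective_Cauchy v"
  shows "abs_ptensor u - abs_ptensor v = abs_ptensor (\<lambda>n. u n - v n)"
    and "projective_Cauchy (\<lambda>n. u n - v n)"
proof -
  note scale = projective_Cauchy_scale[OF assms(2), of "-1"]
  have "- abs_ptensor v = abs_ptensor (\<lambda>n. (-1) *\<^sub>R v n)"
    unfolding uminus_ptensor_def
    by (rule scaleR_ptensor.abs_eq) (rule ptensor_rel_refl[OF assms(2)])
  then have "abs_ptensor u + - abs_ptensor v = abs_ptensor (\<lambda>n. u n + (-1) *\<^sub>R v n)"
    using plus_ptensor.abs_eq[OF ptensor_rel_refl[OF assms(1)] ptensor_rel_refl[OF scale]] by metis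
  then show "abs_ptensor u - abs_ptensor v = abs_ptensor (\<lambda>n. u n - v n)"
    by simp
  show "projective_Cauchy (\<lambda>n. u n - v n)"
    using projective_Cauchy_add[OF assms(1) projective_Cauchy_scale[OF assms(2), of "-1"]] by simp
qed

lemma tensor_to_ptensor_diff:
  "tensor_to_ptensor (s - t) = tensor_to_ptensor s - tensor_to_ptensor t"
  by (simp add: tensor_to_ptensor_def abs_ptensor_diff projective_Cauchy_const)

lemma tensor_to_ptensor_LIMSEQ:
  assumes u: "projective_Cauchy u"
  shows "(\<lambda>n. tensor_to_ptensor (u n)) \<longlonglongrightarrow> abs_ptensor u"
proof (rule LIMSEQ_I)
  fix e :: real assume "0 < e"
  then have "0 < e / 2" by simp
  then obtain N where N: "\<And>m n. N \<le> m \<Longrightarrow> N \<le> n \<Longrightarrow> projective_norm (u m - u n) < e / 2"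
    using u unfolding projective_Cauchy_def by meson
  show "\<exists>N. \<forall>n\<ge>N. norm (tensor_to_ptensor (u n) - abs_ptensor u) < e"
  proof (intro exI[of _ N] allI impI)
    fix n assume n: "N \<le> n"
    have "(\<lambda>m. projective_norm (u n - u m)) \<longlonglongrightarrow> norm (tensor_to_ptensor (u n) - abs_ptensor u)"
      using abs_ptensor_diff[OF projective_Cauchy_const u, of "u n"]
      by (metis (no_types) norm_ptensor_LIMSEQ tensor_to_ptensor_def)
    then have "norm (tensor_to_ptensor (u n) - abs_ptensor u) \<le> e / 2"
      using N n by (intro LIMSEQ_le_const2) (auto intro!: exI[of _ N] less_imp_le)
    then show "norm (tensor_to_ptensor (u n) - abs_ptensor u) < e" using \<open>0 < e\<close> by simp
  qed
qed

instance ptensor :: (real_normed_vector, real_normed_vector) banach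
proof
  fix X :: "nat \<Rightarrow> ('a, 'b) ptensor"
  assume X: "Cauchy X"
  have "\<exists>t. norm (X k - tensor_to_ptensor t) < inverse (Suc k)" for k
  proof -
    obtain u where "projective_Cauchy u" "X k = abs_ptensor u" by (rule ptensor_cases)
    with LIMSEQ_D[OF tensor_to_ptensor_LIMSEQ, of u "inverse (Suc k)"] show ?thesis
      by (force simp: norm_minus_commute)
  qed
  then obtain u where u: "\<And>k. norm (X k - tensor_to_ptensor (u k)) < inverse (Suc k)" by metis
  have null: "(\<lambda>k. X k - tensor_to_ptensor (u k)) \<longlonglongrightarrow> 0"
    by (rule Lim_null_comparison[OF _ LIMSEQ_inverse_real_of_nat]) (intro always_eventually allI less_imp_le u)
  have "projective_Cauchy u"
    unfolding projective_Cauchy_def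
  proof (intro allI impI)
    fix e :: real assume "0 < e"
    then have e: "0 < e / 3" by simp
    obtain M where M: "\<And>m n. M \<le> m \<Longrightarrow> M \<le> n \<Longrightarrow> norm (X m - X n) < e / 3"
      using CauchyD[OF X e] by blast
    obtain N where N: "\<And>n. N \<le> n \<Longrightarrow> norm (X n - tensor_to_ptensor (u n)) < e / 3"
      using LIMSEQ_D[OF null e] by auto
    show "\<exists>K. \<forall>m\<ge>K. \<forall>n\<ge>K. projective_norm (u m - u n) < e"
    proof (intro exI[of _ "max M N"] allI impI)
      fix m n assume mn: "max M N \<le> m" "max M N \<le> n"
      have "norm (tensor_to_ptensor (u m) - tensor_to_ptensor (u n))
          = norm ((X m - X n) - (X m - tensor_to_ptensor (u m))
              + (X n - tensor_to_ptensor (u n)))" by simp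
      also have "\<dots> \<le> norm (X m - X n) + norm (X m - tensor_to_ptensor (u m))
          + norm (X n - tensor_to_ptensor (u n))"
        by (intro norm_triangle_le add_right_mono norm_triangle_ineq4)
      also have "\<dots> < e / 3 + e / 3 + e / 3"
        using mn by (intro add_strict_mono M N) auto
      finally show "projective_norm (u m - u n) < e"
        by (simp flip: norm_tensor_to_ptensor add: tensor_to_ptensor_diff)
    qed
  qed
  from tendsto_add[OF null tensor_to_ptensor_LIMSEQ[OF this]] show "convergent X"
    by (auto simp: convergent_def)
qed

section \<open>Bounded operators as the dual of the projective tensor product\<close>

text \<open>The functional of \<open>T\<close> sends \<open>x \<otimes> y\<close> to \<open>T x y\<close> and is extended to the completion by
  continuity. By \<open>linear_ptensor_functional\<close>, \<open>norm_ptensor_functional\<close> and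
  \<open>surj_ptensor_functional\<close> below this is an isometric identification.\<close>

lemma bilinear_blinfun: "bilinear (\<lambda>x y. blinfun_apply (blinfun_apply T x) y)"
  for T :: "'a::real_normed_vector \<Rightarrow>\<^sub>L 'b::real_normed_vector \<Rightarrow>\<^sub>L real"
  by (auto simp: bilinear_def intro!: linearI
      simp: blinfun.add_left blinfun.add_right blinfun.scaleR_left blinfun.scaleR_right)

lift_definition tensor_pairing :: "('a::real_normed_vector \<Rightarrow>\<^sub>L 'b::real_normed_vector \<Rightarrow>\<^sub>L real) \<Rightarrow>
    ('a, 'b) tensor \<Rightarrow> real"
  is "\<lambda>T xs. \<Sum>(x, y)\<leftarrow>xs. blinfun_apply (blinfun_apply T x) y"
  using bilinear_blinfun by (fastforce simp: tensor_rel_def tensor_eval_def)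

lemma tensor_pairing_linear:
  "tensor_pairing T (s + t) = tensor_pairing T s + tensor_pairing T t"
  "tensor_pairing T (c *\<^sub>R t) = c * tensor_pairing T t"
proof -
  show "tensor_pairing T (s + t) = tensor_pairing T s + tensor_pairing T t"
    by transfer simp
  show "tensor_pairing T (c *\<^sub>R t) = c * tensor_pairing T t"
    by transfer (simp add: tensor_eval_scale[OF bilinear_blinfun, unfolded tensor_eval_def] del: map_map)
qed

lemma tensor_pairing_diff: "tensor_pairing T (s - t) = tensor_pairing T s - tensor_pairing T t"
  using tensor_pairing_linear(1)[of T "s - t" t] by simp

lemma tensor_pairing_bound: "\<bar>tensor_pairing T t\<bar> \<le> norm T * projective_norm t"
proof (rule field_le_epsilon)
  fix e :: real assume "0 < e"
  define d where "d = e / (norm T + 1)"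
  have "0 < norm T + 1" by (smt (verit) norm_ge_zero)
  then have d: "0 < d" "norm T * d \<le> e"
    using \<open>0 < e\<close> by (auto simp: d_def field_simps)
  obtain xs where xs: "abs_tensor xs = t"
    "(\<Sum>(x, y)\<leftarrow>xs. norm x * norm y) < projective_norm t + d"
    using d(1) by (rule projective_norm_approx)
  have "\<bar>\<Sum>(x, y)\<leftarrow>xs. blinfun_apply (blinfun_apply T x) y\<bar>
      \<le> norm T * (\<Sum>(x, y)\<leftarrow>xs. norm x * norm y)"
  proof (induction xs)
    case (Cons p xs)
    obtain x y where p: "p = (x, y)" by force
    have "\<bar>blinfun_apply (blinfun_apply T x) y\<bar> \<le> norm (blinfun_apply T x) * norm y"
      using norm_blinfun[of "blinfun_apply T x" y] by simp
    also have "\<dots> \<le> norm T * norm x * norm y"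
      by (intro mult_right_mono norm_blinfun) auto
    finally show ?case using Cons by (auto simp: p algebra_simps)
  qed simp
  then have "\<bar>tensor_pairing T t\<bar> \<le> norm T * (\<Sum>(x, y)\<leftarrow>xs. norm x * norm y)"
    using tensor_pairing.abs_eq[of T xs] xs(1) by simp
  also have "\<dots> \<le> norm T * (projective_norm t + d)"
    using xs(2) by (intro mult_left_mono) auto
  finally show "\<bar>tensor_pairing T t\<bar> \<le> norm T * projective_norm t + e"
    using d(2) by (simp add: algebra_simps)
qed

lemma tensor_pairing_convergent:
  assumes "projective_Cauchy u"
  shows "convergent (\<lambda>n. tensor_pairing T (u n))"
proof (rule Cauchy_convergent, rule metric_CauchyI)
  fix e :: real assume "0 < e"
  define d where "d = e / (norm T + 1)"
  have "0 < norm T + 1" by (smt (verit) norm_ge_zero)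
  then have d: "0 < d" "norm T * d < e"
    using \<open>0 < e\<close> by (auto simp: d_def field_simps)
  from d(1) obtain N where N: "\<forall>m\<ge>N. \<forall>n\<ge>N. projective_norm (u m - u n) < d"
    using assms unfolding projective_Cauchy_def by meson
  show "\<exists>N. \<forall>m\<ge>N. \<forall>n\<ge>N. dist (tensor_pairing T (u m)) (tensor_pairing T (u n)) < e"
  proof (intro exI[of _ N] allI impI)
    fix m n assume "N \<le> m" "N \<le> n"
    with N have "projective_norm (u m - u n) \<le> d" by (auto intro: less_imp_le)
    then have "norm T * projective_norm (u m - u n) \<le> norm T * d"
      by (rule mult_left_mono) simp
    then show "dist (tensor_pairing T (u m)) (tensor_pairing T (u n)) < e"
      using d(2) tensor_pairing_bound[of T "u m - u n"]
      by (simp add: dist_real_def tensor_pairing_diff)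
  qed
qed

lift_definition ptensor_pairing :: "('a::real_normed_vector \<Rightarrow>\<^sub>L 'b::real_normed_vector \<Rightarrow>\<^sub>L real) \<Rightarrow>
    ('a, 'b) ptensor \<Rightarrow> real"
  is "\<lambda>T u. lim (\<lambda>n. tensor_pairing T (u n))"
proof -
  fix T :: "'a \<Rightarrow>\<^sub>L 'b \<Rightarrow>\<^sub>L real" and u v :: "nat \<Rightarrow> ('a, 'b) tensor"
  assume *: "ptensor_rel u v"
  then have "(\<lambda>n. norm T * projective_norm (u n - v n)) \<longlonglongrightarrow> norm T * 0"
    unfolding ptensor_rel_def by (intro tendsto_intros) auto
  then have "(\<lambda>n. norm T * projective_norm (u n - v n)) \<longlonglongrightarrow> 0" by simp
  then have "(\<lambda>n. tensor_pairing T (u n) - tensor_pairing T (v n)) \<longlonglongrightarrow> 0"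
    by (rule null_le) (unfold tensor_pairing_diff[symmetric], rule tensor_pairing_bound)
  with * show "lim (\<lambda>n. tensor_pairing T (u n)) = lim (\<lambda>n. tensor_pairing T (v n))"
    unfolding ptensor_rel_def by (intro lim_cong_null tensor_pairing_convergent) auto
qed

lemma ptensor_pairing_LIMSEQ:
  assumes "projective_Cauchy u"
  shows "(\<lambda>n. tensor_pairing T (u n)) \<longlonglongrightarrow> ptensor_pairing T (abs_ptensor u)"
  using tensor_pairing_convergent[OF assms]
    ptensor_pairing.abs_eq[OF ptensor_rel_refl[OF assms]]
  by (simp add: convergent_LIMSEQ_iff)

lemma ptensor_pairing_bound: "\<bar>ptensor_pairing T t\<bar> \<le> norm T * norm t"
proof -
  obtain u where u: "projective_Cauchy u" "t = abs_ptensor u" by (rule ptensor_cases)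
  show ?thesis
    unfolding u(2)
    using tendsto_rabs[OF ptensor_pairing_LIMSEQ[OF u(1)]]
      tendsto_mult_left[OF norm_ptensor_LIMSEQ[OF u(1)]]
    by (rule LIMSEQ_le) (auto intro: tensor_pairing_bound)
qed

lemma bounded_linear_ptensor_pairing: "bounded_linear (ptensor_pairing T)"
proof (rule bounded_linear_intro)
  fix s t :: "('a, 'b) ptensor" and c :: real
  obtain u where u: "projective_Cauchy u" "s = abs_ptensor u" by (rule ptensor_cases)
  obtain v where v: "projective_Cauchy v" "t = abs_ptensor v" by (rule ptensor_cases)
  have st: "s + t = abs_ptensor (\<lambda>n. u n + v n)" and cs: "c *\<^sub>R s = abs_ptensor (\<lambda>n. c *\<^sub>R u n)"
    using u v by (simp_all add: plus_ptensor.abs_eq scaleR_ptensor.abs_eq ptensor_rel_Cauchy)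
  note U = ptensor_pairing_LIMSEQ[OF u(1), of T, folded u(2)]
  note V = ptensor_pairing_LIMSEQ[OF v(1), of T, folded v(2)]
  show "ptensor_pairing T (s + t) = ptensor_pairing T s + ptensor_pairing T t"
    using ptensor_pairing_LIMSEQ[OF projective_Cauchy_add[OF u(1) v(1)], of T, folded st]
      tendsto_add[OF U V]
    by (auto simp: tensor_pairing_linear intro: LIMSEQ_unique)
  show "ptensor_pairing T (c *\<^sub>R s) = c *\<^sub>R ptensor_pairing T s"
    using ptensor_pairing_LIMSEQ[OF projective_Cauchy_scale[OF u(1)], of T c, folded cs]
      tendsto_mult_left[OF U, of c]
    by (auto simp: tensor_pairing_linear intro: LIMSEQ_unique)
  show "norm (ptensor_pairing T s) \<le> norm s * norm T"
    using ptensor_pairing_bound[of T s] by (simp add: mult.commute)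
qed

lift_definition ptensor_functional ::
    "('a::real_normed_vector \<Rightarrow>\<^sub>L 'b::real_normed_vector \<Rightarrow>\<^sub>L real) \<Rightarrow> ('a, 'b) ptensor \<Rightarrow>\<^sub>L real"
  is ptensor_pairing
  by (rule bounded_linear_ptensor_pairing)

definition ptensor_of :: "'a::real_normed_vector \<Rightarrow> 'b::real_normed_vector \<Rightarrow> ('a, 'b) ptensor"
  where "ptensor_of x y = tensor_to_ptensor (abs_tensor [(x, y)])"

lemma ptensor_functional_tensor:
  "blinfun_apply (ptensor_functional T) (tensor_to_ptensor t) = tensor_pairing T t"
  using ptensor_pairing_LIMSEQ[OF projective_Cauchy_const, of T t]
  by (simp add: ptensor_functional.rep_eq tensor_to_ptensor_def LIMSEQ_const_iff)

lemma ptensor_functional_ptensor_of: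
  "blinfun_apply (ptensor_functional T) (ptensor_of x y) = blinfun_apply (blinfun_apply T x) y"
  by (simp add: ptensor_of_def ptensor_functional_tensor tensor_pairing.abs_eq)

lemma norm_ptensor_of_le: "norm (ptensor_of x y) \<le> norm x * norm y"
  unfolding ptensor_of_def norm_tensor_to_ptensor using projective_norm_le[of "[(x, y)]"] by simp

lemma norm_ptensor_functional: "norm (ptensor_functional T) = norm T"
proof (rule antisym)
  show "norm (ptensor_functional T) \<le> norm T"
    by (rule norm_blinfun_bound) (auto simp: ptensor_functional.rep_eq ptensor_pairing_bound)
  show "norm T \<le> norm (ptensor_functional T)"
  proof (rule norm_blinfun_bound[OF norm_ge_zero])
    fix x
    show "norm (blinfun_apply T x) \<le> norm (ptensor_functional T) * norm x"
    proof (rule norm_blinfun_bound[OF mult_nonneg_nonneg[OF norm_ge_zero norm_ge_zero]])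
      fix y
      have "norm (blinfun_apply (blinfun_apply T x) y)
          \<le> norm (ptensor_functional T) * norm (ptensor_of x y)"
        using norm_blinfun[of "ptensor_functional T" "ptensor_of x y"]
        by (simp add: ptensor_functional_ptensor_of)
      also have "\<dots> \<le> norm (ptensor_functional T) * (norm x * norm y)"
        by (intro mult_left_mono norm_ptensor_of_le) auto
      finally show "norm (blinfun_apply (blinfun_apply T x) y)
          \<le> norm (ptensor_functional T) * norm x * norm y" by (simp add: mult.assoc)
    qed
  qed
qed

lemma tensor_to_ptensor_linear:
  "tensor_to_ptensor (s + t) = tensor_to_ptensor s + tensor_to_ptensor t"
  "tensor_to_ptensor (c *\<^sub>R t) = c *\<^sub>R tensor_to_ptensor t"
  unfolding tensor_to_ptensor_def
  by (simp_all add: plus_ptensor.abs_eq scaleR_ptensor.abs_eq ptensor_rel_Cauchy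
      projective_Cauchy_const)

lemma tensor_eqI:
  assumes "\<And>B :: 'a::real_normed_vector \<Rightarrow> 'b::real_normed_vector \<Rightarrow> real. bilinear B \<Longrightarrow>
    tensor_eval B xs = tensor_eval B ys"
  shows "abs_tensor xs = abs_tensor ys"
  using assms by (simp add: tensor.abs_eq_iff tensor_rel_def)

lemma ptensor_of_bilinear:
  "ptensor_of (x + x') y = ptensor_of x y + ptensor_of x' y"
  "ptensor_of x (y + y') = ptensor_of x y + ptensor_of x y'"
  "ptensor_of (c *\<^sub>R x) y = c *\<^sub>R ptensor_of x y"
  "ptensor_of x (c *\<^sub>R y) = c *\<^sub>R ptensor_of x y"
  unfolding ptensor_of_def tensor_to_ptensor_linear[symmetric] plus_tensor.abs_eq
    scaleR_tensor.abs_eq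
  by (rule arg_cong[where f = tensor_to_ptensor], rule tensor_eqI,
      simp add: tensor_eval_simps bilinear_ladd bilinear_radd bilinear_lmul bilinear_rmul)+

lemma ptensor_functional_eqI:
  fixes f g :: "('a::real_normed_vector, 'b::real_normed_vector) ptensor \<Rightarrow>\<^sub>L real"
  assumes "\<And>x y. blinfun_apply f (ptensor_of x y) = blinfun_apply g (ptensor_of x y)"
  shows "f = g"
proof (rule blinfun_eqI)
  fix t :: "('a, 'b) ptensor"
  have list: "blinfun_apply f (tensor_to_ptensor (abs_tensor xs))
      = blinfun_apply g (tensor_to_ptensor (abs_tensor xs))" for xs :: "('a \<times> 'b) list"
  proof (induction xs)
    case Nil
    have "abs_tensor [] = (0 :: ('a, 'b) tensor)" by (simp add: zero_tensor_def)
    moreover have "tensor_to_ptensor (0 :: ('a, 'b) tensor) = 0"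
      by (simp add: tensor_to_ptensor_def zero_ptensor_def)
    ultimately show ?case by simp
  next
    case (Cons p xs)
    obtain x y where p: "p = (x, y)" by force
    have "abs_tensor (p # xs) = abs_tensor [(x, y)] + abs_tensor xs"
      by (simp add: p plus_tensor.abs_eq)
    then show ?case
      using Cons assms[of x y]
      by (simp add: tensor_to_ptensor_linear blinfun.add_right ptensor_of_def)
  qed
  have eq: "blinfun_apply f (tensor_to_ptensor s) = blinfun_apply g (tensor_to_ptensor s)" for s
    using ex_abs_tensor[of s] list by metis
  obtain u where u: "projective_Cauchy u" "t = abs_ptensor u" by (rule ptensor_cases)
  have lim: "(\<lambda>n. tensor_to_ptensor (u n)) \<longlonglongrightarrow> t"
    unfolding u(2) by (rule tensor_to_ptensor_LIMSEQ[OF u(1)])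
  have F: "(\<lambda>n. blinfun_apply f (tensor_to_ptensor (u n))) \<longlonglongrightarrow> blinfun_apply f t"
    and G: "(\<lambda>n. blinfun_apply g (tensor_to_ptensor (u n))) \<longlonglongrightarrow> blinfun_apply g t"
    by (intro tendsto_intros lim)+
  show "blinfun_apply f t = blinfun_apply g t"
    using F G unfolding eq by (rule LIMSEQ_unique)
qed

lemma linear_ptensor_functional: "linear ptensor_functional"
  by (intro linearI ptensor_functional_eqI)
    (simp_all add: ptensor_functional_ptensor_of blinfun.add_left blinfun.scaleR_left)

lemma surj_ptensor_functional:
  "surj (ptensor_functional ::
    ('a::real_normed_vector \<Rightarrow>\<^sub>L 'b::real_normed_vector \<Rightarrow>\<^sub>L real) \<Rightarrow> ('a, 'b) ptensor \<Rightarrow>\<^sub>L real)"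
unfolding surj_def
proof
  fix f :: "('a, 'b) ptensor \<Rightarrow>\<^sub>L real"
  define g where "g x y = blinfun_apply f (ptensor_of x y)" for x y
  have "bounded_bilinear g"
  proof
    show "\<exists>K. \<forall>a b. norm (g a b) \<le> norm a * norm b * K"
    proof (intro exI allI)
      fix a b
      have "norm (g a b) \<le> norm f * norm (ptensor_of a b)" unfolding g_def by (rule norm_blinfun)
      also have "\<dots> \<le> norm f * (norm a * norm b)"
        by (intro mult_left_mono norm_ptensor_of_le) auto
      finally show "norm (g a b) \<le> norm a * norm b * norm f" by (simp add: mult.commute)
    qed
  qed (auto simp: g_def ptensor_of_bilinear blinfun.add_right blinfun.scaleR_right)
  then interpret g: bounded_bilinear g .
  define T where "T = Blinfun g.prod_right"
  have "blinfun_apply (blinfun_apply T x) y = g x y" for x y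
    by (simp add: T_def bounded_linear_Blinfun_apply g.bounded_linear_prod_right
        g.prod_right.rep_eq)
  then have "f = ptensor_functional T"
    by (intro ptensor_functional_eqI) (simp add: ptensor_functional_ptensor_of g_def)
  then show "\<exists>T. f = ptensor_functional T" ..
qed

section \<open>Weak topologies and Namioka points\<close>

text \<open>Note that \<^const>\<open>euclidean\<close> at a function type is the product topology, so the topologies below
  are the initial ones for the evaluation maps.\<close>

definition weak_topology :: "'w::real_normed_vector topology"
  where "weak_topology =
    pullback_topology UNIV (\<lambda>z (\<phi> :: 'w \<Rightarrow>\<^sub>L real). blinfun_apply \<phi> z) euclidean"

definition weak_star_topology :: "('z::real_normed_vector \<Rightarrow>\<^sub>L real) topology"
  where "weak_star_topology = pullback_topology UNIV blinfun_apply euclidean"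

definition operator_weak_star_topology ::
    "('a::real_normed_vector \<Rightarrow>\<^sub>L 'b::real_normed_vector \<Rightarrow>\<^sub>L real) topology"
  where "operator_weak_star_topology =
    pullback_topology UNIV ptensor_functional weak_star_topology"

text \<open>\<open>'w\<close> is meant to be a dual space and \<open>W\<close> its weak* topology, which is a parameter since it depends
  on the predual.\<close>

definition namioka_point :: "'w::real_normed_vector topology \<Rightarrow> 'w \<Rightarrow> bool"
  where "namioka_point W z \<longleftrightarrow> z \<in> cball 0 1 \<and>
    topcontinuous_at (subtopology W (cball 0 1)) (subtopology weak_topology (cball 0 1)) id z"

lift_definition rank_one_operator ::
    "('a::real_normed_vector \<Rightarrow>\<^sub>L real) \<Rightarrow> 'b::real_normed_vector \<Rightarrow> 'a \<Rightarrow>\<^sub>L 'b"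
  is "\<lambda>f y x. f x *\<^sub>R y"
  by (rule bounded_linear_scaleR_const)

end

theory Submission
  imports Defs
begin

text \<open>
  The two claims are instances of one transfer principle (\<open>namioka_point_retract\<close>). Let \<open>J\<close> map
  the unit ball of \<open>Z\<close> into that of \<open>W\<close>, continuously for the weak* topologies, and let \<open>P\<close> be a
  bounded linear left inverse of \<open>J\<close>. The identity of the ball of \<open>Z\<close> factors as \<open>P \<circ> id \<circ> J\<close>:
  the map \<open>J\<close> is weak*-to-weak* continuous, the middle identity is weak*-to-weak continuous at \<open>J z\<close>
  if \<open>J z\<close> is a Namioka point, and \<open>P\<close> is weak-to-weak continuous like every bounded linear map. So
  \<open>z\<close> is a Namioka point as soon as \<open>J z\<close> is.

  For \<open>x\<^sub>0\<^sup>*\<close> take \<open>J x\<^sup>* = x\<^sup>* \<otimes> y\<^sub>0\<^sup>*\<close>. Since \<open>y\<^sub>0\<^sup>* \<noteq> 0\<close> there is a vector \<open>y\<close> with \<open>y\<^sub>0\<^sup>*(y) \<noteq> 0\<close>, and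
  \<open>P T = (\<lambda>x. T x y / y\<^sub>0\<^sup>*(y))\<close> undoes \<open>J\<close>. For \<open>y\<^sub>0\<^sup>*\<close> take \<open>J y\<^sup>* = x\<^sub>0\<^sup>* \<otimes> y\<^sup>*\<close> and
  \<open>P T = T x / x\<^sub>0\<^sup>*(x)\<close>, where \<open>x\<^sub>0\<^sup>*(x) \<noteq> 0\<close>.

  What remains is the weak* continuity of \<open>J\<close> on the ball. On a norm bounded set of operators the
  weak* topology is given by the elementary tensors alone (\<open>continuous_map_operator_weak_star\<close>), and
  there \<open>(x\<^sup>* \<otimes> y\<^sup>*)(x \<otimes> y) = x\<^sup>*(x) y\<^sup>*(y)\<close> is visibly weak* continuous in each factor.
\<close>

section \<open>Initial topologies\<close>

lemma continuous_map_into_pullback_iff: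
  "continuous_map X (pullback_topology UNIV g T) f \<longleftrightarrow> continuous_map X T (g \<circ> f)"
proof
  assume "continuous_map X (pullback_topology UNIV g T) f"
  moreover have "continuous_map (pullback_topology UNIV g T) T g"
    using continuous_map_pullback[OF continuous_map_id, of UNIV g T] by simp
  ultimately show "continuous_map X T (g \<circ> f)"
    by (rule continuous_map_compose)
next
  assume "continuous_map X T (g \<circ> f)"
  then show "continuous_map X (pullback_topology UNIV g T) f"
    by (rule continuous_map_pullback') auto
qed

lemma continuous_map_euclidean_fun_iff:
  fixes f :: "'x \<Rightarrow> 'i \<Rightarrow> 'r::topological_space"
  shows "continuous_map X euclidean f \<longleftrightarrow> (\<forall>i. continuous_map X euclidean (\<lambda>x. f x i))"
  by (metis (no_types) continuous_map_componentwise_UNIV euclidean_product_topology)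

lemma continuous_map_weak_iff:
  "continuous_map X weak_topology f \<longleftrightarrow>
    (\<forall>\<phi>. continuous_map X euclideanreal (\<lambda>x. blinfun_apply \<phi> (f x)))"
  by (simp add: weak_topology_def continuous_map_into_pullback_iff o_def
      continuous_map_euclidean_fun_iff)

lemma continuous_map_weak_star_iff:
  "continuous_map X weak_star_topology f \<longleftrightarrow>
    (\<forall>z. continuous_map X euclideanreal (\<lambda>x. blinfun_apply (f x) z))"
  by (simp add: weak_star_topology_def continuous_map_into_pullback_iff o_def
      continuous_map_euclidean_fun_iff)

lemma continuous_map_operator_weak_star_iff:
  "continuous_map X operator_weak_star_topology f \<longleftrightarrow>
    (\<forall>t. continuous_map X euclideanreal (\<lambda>x. blinfun_apply (ptensor_functional (f x)) t))"
  by (simp add: operator_weak_star_topology_def continuous_map_into_pullback_iff o_def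
      continuous_map_weak_star_iff)

lemma topspace_weak_topology [simp]: "topspace weak_topology = UNIV"
  by (simp add: weak_topology_def topspace_pullback_topology)

lemma topspace_weak_star_topology [simp]: "topspace weak_star_topology = UNIV"
  by (simp add: weak_star_topology_def topspace_pullback_topology)

lemma continuous_map_weak_star_eval:
  "continuous_map (subtopology weak_star_topology S) euclideanreal (\<lambda>f. blinfun_apply f z)"
  by (intro continuous_map_from_subtopology
      continuous_map_weak_star_iff[THEN iffD1, rule_format, OF continuous_map_id, unfolded id_apply])

lemma bounded_linear_imp_weakly_continuous:
  assumes "bounded_linear P"
  shows "continuous_map weak_topology weak_topology P"
  unfolding continuous_map_weak_iff
proof
  fix \<phi>
  have "continuous_map weak_topology euclideanreal (\<lambda>w. blinfun_apply (\<phi> o\<^sub>L Blinfun P) w)"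
    by (rule continuous_map_weak_iff[THEN iffD1, rule_format, OF continuous_map_id, unfolded id_apply])
  then show "continuous_map weak_topology euclideanreal (\<lambda>w. blinfun_apply \<phi> (P w))"
    by (simp add: bounded_linear_Blinfun_apply assms)
qed

section \<open>Transfer of Namioka points to retracts\<close>

text \<open>
  The left inverse \<open>P\<close> need not map the unit ball into itself: a weakly open set \<open>V\<close> is pulled back
  along \<open>P\<close> before it is intersected with the ball, and elements of the ball return to it because
  \<open>P (J y) = y\<close>.
\<close>
lemma namioka_point_retract:
  fixes J :: "'z::real_normed_vector \<Rightarrow> 'w::real_normed_vector"
  assumes J: "continuous_map (subtopology Z (cball 0 1)) (subtopology W (cball 0 1)) J"
    and P: "bounded_linear P" "\<And>z. P (J z) = z"
    and z: "z \<in> topspace Z" "z \<in> cball 0 1"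
    and nam: "namioka_point W (J z)"
  shows "namioka_point Z z"
  unfolding namioka_point_def topcontinuous_at_def
proof (intro conjI allI impI)
  fix V assume "openin (subtopology weak_topology (cball 0 1)) V \<and> id z \<in> V"
  then obtain V' where V': "openin weak_topology V'" "V = V' \<inter> cball 0 1" "z \<in> V'"
    by (auto simp: openin_subtopology)
  define Q where "Q = P -` V' \<inter> cball 0 1"
  have "openin weak_topology (P -` V')"
    using openin_continuous_map_preimage[OF bounded_linear_imp_weakly_continuous[OF P(1)] V'(1)]
    by (simp add: vimage_def)
  then have "openin (subtopology weak_topology (cball 0 1)) Q"
    by (auto simp: Q_def openin_subtopology)
  moreover have "J z \<in> Q"
    using nam V'(3) P(2) by (auto simp: Q_def namioka_point_def)
  ultimately obtain U where U: "openin (subtopology W (cball 0 1)) U" "J z \<in> U" "U \<subseteq> Q"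
    using nam unfolding namioka_point_def topcontinuous_at_def by (auto simp: subset_iff)
  let ?U = "{y \<in> topspace (subtopology Z (cball 0 1)). J y \<in> U}"
  have "id y \<in> V" if "y \<in> ?U" for y
  proof -
    have "J y \<in> P -` V'" using that U(3) by (auto simp: Q_def)
    then show ?thesis using that P(2) V'(2) by auto
  qed
  moreover have "openin (subtopology Z (cball 0 1)) ?U"
    using J U(1) by (rule openin_continuous_map_preimage)
  ultimately show "\<exists>U. openin (subtopology Z (cball 0 1)) U \<and> z \<in> U \<and> (\<forall>y\<in>U. id y \<in> V)"
    using z U(2) by (intro exI[of _ ?U]) auto
qed (use z in auto)

section \<open>The weak* topology on bounded sets of operators\<close>

text \<open>
  Finite sums of elementary tensors are dense in the projective tensor product. Pairing with a
  general element is therefore, uniformly on the unit ball of operators, a limit of pairings with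
  finite sums, and uniform limits of continuous functions are continuous.
\<close>
lemma continuous_map_operator_weak_star:
  fixes F :: "'x \<Rightarrow> 'a::real_normed_vector \<Rightarrow>\<^sub>L 'b::real_normed_vector \<Rightarrow>\<^sub>L real"
  assumes F: "\<And>x y. continuous_map X euclideanreal (\<lambda>z. blinfun_apply (blinfun_apply (F z) x) y)"
    and bd: "\<And>z. z \<in> topspace X \<Longrightarrow> norm (F z) \<le> 1"
  shows "continuous_map X operator_weak_star_topology F"
  unfolding continuous_map_operator_weak_star_iff
proof
  fix t :: "('a, 'b) ptensor"
  obtain u where u: "projective_Cauchy u" "t = abs_ptensor u" by (rule ptensor_cases)
  define s where "s n = tensor_to_ptensor (u n)" for n
  have lim: "s \<longlonglongrightarrow> t"
    unfolding u(2) s_def by (rule tensor_to_ptensor_LIMSEQ[OF u(1)])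
  have list: "continuous_map X euclideanreal (\<lambda>z. tensor_pairing (F z) (abs_tensor xs))" for xs
    unfolding tensor_pairing.abs_eq
    by (induction xs) (auto intro!: continuous_intros F simp: case_prod_unfold)
  have fin: "continuous_map X euclideanreal (\<lambda>z. blinfun_apply (ptensor_functional (F z)) (s n))"
    for n
    using ex_abs_tensor[of "u n"] list unfolding s_def ptensor_functional_tensor by metis
  have unif: "\<forall>\<^sub>F n in sequentially. \<forall>z\<in>topspace X.
      dist (blinfun_apply (ptensor_functional (F z)) (s n))
        (blinfun_apply (ptensor_functional (F z)) t) < e" if "0 < e" for e
    using tendstoD[OF lim that]
  proof eventually_elim
    case (elim n)
    show ?case
    proof
      fix z assume z: "z \<in> topspace X"
      have "dist (blinfun_apply (ptensor_functional (F z)) (s n))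
          (blinfun_apply (ptensor_functional (F z)) t)
          = norm (blinfun_apply (ptensor_functional (F z)) (s n - t))"
        by (simp add: dist_norm blinfun.diff_right)
      also have "\<dots> \<le> norm (F z) * norm (s n - t)"
        using norm_blinfun[of "ptensor_functional (F z)"] by (simp add: norm_ptensor_functional)
      also have "\<dots> \<le> 1 * norm (s n - t)"
        using bd[OF z] by (rule mult_right_mono) simp
      also have "\<dots> < e"
        using elim by (simp add: dist_norm)
      finally show "dist (blinfun_apply (ptensor_functional (F z)) (s n))
        (blinfun_apply (ptensor_functional (F z)) t) < e" .
    qed
  qed
  show "continuous_map X euclideanreal (\<lambda>z. blinfun_apply (ptensor_functional (F z)) t)"
    unfolding mtopology_is_euclidean[symmetric]
  proof (rule Met_TC.continuous_map_uniform_limit)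
    show "\<forall>\<^sub>F n in sequentially. continuous_map X Met_TC.mtopology
        (\<lambda>z. blinfun_apply (ptensor_functional (F z)) (s n))"
      using fin by simp
  qed (use unif in simp_all)
qed

lemma norm_rank_one_operator_le: "norm (rank_one_operator f y) \<le> norm f * norm y"
proof (rule norm_blinfun_bound)
  fix x
  show "norm (blinfun_apply (rank_one_operator f y) x) \<le> norm f * norm y * norm x"
    using mult_right_mono[OF norm_blinfun[of f x] norm_ge_zero[of y]]
    by (simp add: rank_one_operator.rep_eq mult.commute mult.left_commute)
qed simp

text \<open>
  On elementary tensors a rank one operator is the product of the values of its factors, so the
  dependence is even jointly continuous while both factors stay in the unit ball; the map \<open>J\<close> of
  \<open>namioka_point_retract\<close> is obtained by taking one of them constant.
\<close>
lemma continuous_map_rank_one_operator: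
  fixes f :: "'x \<Rightarrow> 'a::real_normed_vector \<Rightarrow>\<^sub>L real" and g :: "'x \<Rightarrow> 'b::real_normed_vector \<Rightarrow>\<^sub>L real"
  assumes "\<And>x. continuous_map X euclideanreal (\<lambda>z. blinfun_apply (f z) x)"
    and "\<And>y. continuous_map X euclideanreal (\<lambda>z. blinfun_apply (g z) y)"
    and "\<And>z. z \<in> topspace X \<Longrightarrow> norm (f z) \<le> 1" "\<And>z. z \<in> topspace X \<Longrightarrow> norm (g z) \<le> 1"
  shows "continuous_map X (subtopology operator_weak_star_topology (cball 0 1))
    (\<lambda>z. rank_one_operator (f z) (g z))"
proof -
  have norm: "norm (rank_one_operator (f z) (g z)) \<le> 1" if "z \<in> topspace X" for z
    using norm_rank_one_operator_le[of "f z" "g z"] assms(3,4)[OF that]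
      mult_le_one[OF _ norm_ge_zero] by (meson order_trans)
  show ?thesis
    using norm assms(1,2)
    by (intro continuous_map_into_subtopology continuous_map_operator_weak_star)
      (auto simp: rank_one_operator.rep_eq blinfun.scaleR_left intro!: continuous_intros)
qed

lemma nonzero_functional_witness:
  fixes f :: "'a::real_normed_vector \<Rightarrow>\<^sub>L real"
  assumes "f \<in> sphere 0 1"
  obtains x where "blinfun_apply f x \<noteq> 0"
proof -
  have "f \<noteq> 0" using assms by auto
  then show ?thesis using that by (metis blinfun_eqI zero_blinfun.rep_eq)
qed

section \<open>Factors of a rank one Namioka point\<close>

theorem theorem2p1:
  fixes x0 :: "'a::banach \<Rightarrow>\<^sub>L real" and y0 :: "'b::banach \<Rightarrow>\<^sub>L real"
  assumes "x0 \<in> sphere 0 1" and "y0 \<in> sphere 0 1"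
    and "namioka_point operator_weak_star_topology (rank_one_operator x0 y0)"
  shows "namioka_point weak_star_topology x0 \<and> namioka_point weak_star_topology y0"
proof
  have norms: "norm x0 \<le> 1" "norm y0 \<le> 1" using assms(1,2) by auto
  show "namioka_point weak_star_topology x0"
  proof -
    obtain y where y: "blinfun_apply y0 y \<noteq> 0"
      using assms(2) by (rule nonzero_functional_witness)
    define E where "E = Blinfun (\<lambda>f :: 'b \<Rightarrow>\<^sub>L real. inverse (blinfun_apply y0 y) *\<^sub>R blinfun_apply f y)"
    have "bounded_linear (\<lambda>f :: 'b \<Rightarrow>\<^sub>L real. inverse (blinfun_apply y0 y) *\<^sub>R blinfun_apply f y)"
      by (intro bounded_linear_intros)
    then have E: "blinfun_apply E f = inverse (blinfun_apply y0 y) *\<^sub>R blinfun_apply f y" for f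
      by (simp add: E_def bounded_linear_Blinfun_apply)
    show ?thesis
    proof (rule namioka_point_retract[where J = "\<lambda>f. rank_one_operator f y0" and P = "\<lambda>T. E o\<^sub>L T"])
      show "bounded_linear (\<lambda>T. E o\<^sub>L T)"
        by (intro bounded_linear_intros)
      show "E o\<^sub>L rank_one_operator f y0 = f" for f
        using y by (intro blinfun_eqI) (simp add: E rank_one_operator.rep_eq blinfun.scaleR_left)
      show "continuous_map (subtopology weak_star_topology (cball 0 1))
          (subtopology operator_weak_star_topology (cball 0 1)) (\<lambda>f. rank_one_operator f y0)"
        using norms by (intro continuous_map_rank_one_operator continuous_map_weak_star_eval) auto
    qed (use norms assms(3) in auto)
  qed
  show "namioka_point weak_star_topology y0"
  proof -
    obtain x where x: "blinfun_apply x0 x \<noteq> 0"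
      using assms(1) by (rule nonzero_functional_witness)
    show ?thesis
    proof (rule namioka_point_retract[where J = "\<lambda>g. rank_one_operator x0 g" and
          P = "\<lambda>T. inverse (blinfun_apply x0 x) *\<^sub>R blinfun_apply T x"])
      show "bounded_linear (\<lambda>T :: 'a \<Rightarrow>\<^sub>L 'b \<Rightarrow>\<^sub>L real.
          inverse (blinfun_apply x0 x) *\<^sub>R blinfun_apply T x)"
        by (intro bounded_linear_intros)
      show "inverse (blinfun_apply x0 x) *\<^sub>R blinfun_apply (rank_one_operator x0 g) x = g" for g
        using x by (simp add: rank_one_operator.rep_eq)
      show "continuous_map (subtopology weak_star_topology (cball 0 1))
          (subtopology operator_weak_star_topology (cball 0 1)) (\<lambda>g. rank_one_operator x0 g)"
        using norms by (intro continuous_map_rank_one_operator continuous_map_weak_star_eval) auto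
    qed (use norms assms(3) in auto)
  qed
qed

end
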